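(* Let $\mathcal{H}$ be a complex Hilbert space, let $0\le\alpha<\frac{\pi}{2}$, and let $A\in\mathcal{B}(\mathcal{H})$ be such that $W(A)\subset S_\alpha$. Then \[\left(1-2\tan^2(\alpha)\right)\omega^2(A)\le\omega\left(A^2\right).\]
   Context: $\mathcal{B}(\mathcal{H})$ is the $C^*$-algebra of bounded linear operators on the complex Hilbert space $\mathcal{H}$. The numerical range is $W(A)=\{\langle Ax,x\rangle: x\in\mathcal{H},\ \|x\|=1\}$, and the numerical radius is $\omega(A)=\sup_{\|x\|=1}|\langle Ax,x\rangle|$; $\omega^2(A)$ means $(\omega(A))^2$. For $0\le\alpha<\frac{\pi}{2}$, $S_\alpha=\{z\in\mathbb{C}:\operatorname{Re}z>0,\ |\operatorname{Im}z|\le\tan(\alpha)\operatorname{Re}z\}$. *)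

theory Defs
  imports "HOL-Analysis.Analysis"
begin

class complex_vector = real_vector +
  fixes scaleC :: "complex \<Rightarrow> 'a \<Rightarrow> 'a"  (infixr "*\<^sub>C" 75)
  assumes scaleC_add_right: "a *\<^sub>C (x + y) = a *\<^sub>C x + a *\<^sub>C y"
    and scaleC_add_left: "(a + b) *\<^sub>C x = a *\<^sub>C x + b *\<^sub>C x"
    and scaleC_scaleC: "a *\<^sub>C b *\<^sub>C x = (a * b) *\<^sub>C x"
    and scaleC_of_real: "complex_of_real r *\<^sub>C x = r *\<^sub>R x"

text \<open>The inner product is linear in its first argument and conjugate-linear in its second.\<close>

class complex_inner = complex_vector + real_normed_vector +
  fixes cinner :: "'a \<Rightarrow> 'a \<Rightarrow> complex"
  assumes cinner_commute: "cinner x y = cnj (cinner y x)"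
    and cinner_add_left: "cinner (x + y) z = cinner x z + cinner y z"
    and cinner_scaleC_left: "cinner (a *\<^sub>C x) y = a * cinner x y"
    and cinner_ge_zero: "0 \<le> Re (cinner x x)"
    and cinner_eq_zero_iff: "cinner x x = 0 \<longleftrightarrow> x = 0"
    and norm_eq_sqrt_cinner: "norm x = sqrt (Re (cinner x x))"

class complex_hilbert_space = complex_inner + complete_space

instantiation complex :: complex_hilbert_space
begin

definition scaleC_complex :: "complex \<Rightarrow> complex \<Rightarrow> complex"
  where "scaleC_complex a x = a * x"

definition cinner_complex :: "complex \<Rightarrow> complex \<Rightarrow> complex"
  where "cinner_complex x y = x * cnj y"

instance
proof
  fix x :: complex
  show "norm x = sqrt (Re (cinner x x))"
    by (simp add: cinner_complex_def cmod_def power2_eq_square)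
qed (auto simp: scaleC_complex_def cinner_complex_def algebra_simps scaleR_conv_of_real)

end

locale bounded_clinear = bounded_linear f
  for f :: "'a::complex_inner \<Rightarrow> 'b::complex_inner" +
  assumes scaleC: "f (c *\<^sub>C x) = c *\<^sub>C f x"

definition numerical_range :: "('a::complex_inner \<Rightarrow> 'a) \<Rightarrow> complex set"
  where "numerical_range A = {cinner (A x) x | x. norm x = 1}"

text \<open>The supremum is taken in \<open>[0, \<infinity>)\<close>: inserting \<open>0\<close> only matters on the zero space, which has
  no unit vectors and where the numerical radius is thus \<open>0\<close> (\<open>Sup {}\<close> is unspecified on the reals).\<close>

definition numerical_radius :: "('a::complex_inner \<Rightarrow> 'a) \<Rightarrow> real"
  where "numerical_radius A = Sup (insert 0 {cmod (cinner (A x) x) | x. norm x = 1})"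

definition sector :: "real \<Rightarrow> complex set"
  where "sector \<alpha> = {z. 0 < Re z \<and> \<bar>Im z\<bar> \<le> tan \<alpha> * Re z}"

end

theory Submission
  imports Defs
begin

text \<open>Write \<open>t = tan \<alpha>\<close>, \<open>q x = Re \<langle>Ax, x\<rangle>\<close> and \<open>\<beta> = sup q\<close> over unit vectors. The sector condition gives
  \<open>\<omega>(A)\<^sup>2 \<le> (1 + t\<^sup>2) \<beta>\<^sup>2\<close> and \<open>\<bar>Im \<langle>Ay, y\<rangle>\<bar> \<le> t \<beta> \<parallel>y\<parallel>\<^sup>2\<close>. Polarizing the latter form between a unit vector
  \<open>x\<close> and \<open>-\<i> (Ax - \<beta> x)\<close> yields \<open>Re \<langle>A\<^sup>2x, x\<rangle> \<ge> 2 \<beta> q x - (1 + t\<^sup>2) \<beta>\<^sup>2\<close>, so that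
  \<open>\<omega>(A\<^sup>2) \<ge> (1 - t\<^sup>2) \<beta>\<^sup>2\<close>. The claim follows from \<open>(1 - 2 t\<^sup>2) (1 + t\<^sup>2) \<le> 1 - t\<^sup>2\<close>.\<close>

lemma cinner_add_right: "cinner x (y + z) = cinner x y + cinner x z"
  by (metis cinner_add_left cinner_commute complex_cnj_add)

lemma cinner_scaleC_right: "cinner x (a *\<^sub>C y) = cnj a * cinner x y"
  by (metis cinner_commute cinner_scaleC_left complex_cnj_mult)

lemma cinner_scaleR_left: "cinner (r *\<^sub>R x) y = of_real r * cinner x y"
  by (metis cinner_scaleC_left scaleC_of_real)

lemma cinner_scaleR_right: "cinner x (r *\<^sub>R y) = of_real r * cinner x y"
  by (metis cinner_scaleC_right complex_cnj_complex_of_real scaleC_of_real)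

lemma cinner_minus_left: "cinner (- x) y = - cinner x y"
  using cinner_scaleR_left[of "-1" x y] by simp

lemma cinner_minus_right: "cinner x (- y) = - cinner x y"
  using cinner_scaleR_right[of x "-1" y] by simp

lemma cinner_diff_left: "cinner (x - y) z = cinner x z - cinner y z"
  using cinner_add_left[of x "- y" z] by (simp add: cinner_minus_left)

lemma cinner_diff_right: "cinner x (y - z) = cinner x y - cinner x z"
  using cinner_add_right[of x y "- z"] by (simp add: cinner_minus_right)

lemma Re_cinner_commute: "Re (cinner x y) = Re (cinner y x)"
  by (metis cinner_commute cnj.sel(1))

lemma Re_cinner_self: "Re (cinner x x) = (norm x)\<^sup>2"
  by (simp add: norm_eq_sqrt_cinner cinner_ge_zero)

text \<open>The class axioms give homogeneity of the norm for real scalars only; for complex ones it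
  comes from the inner product.\<close>

lemma norm_scaleC: "norm (a *\<^sub>C x) = cmod a * norm (x :: 'a::complex_inner)"
proof -
  have "cinner (a *\<^sub>C x) (a *\<^sub>C x) = of_real ((cmod a)\<^sup>2) * cinner x x"
    using complex_norm_square[of a]
    by (simp add: cinner_scaleC_left cinner_scaleC_right mult.commute)
  then have "(norm (a *\<^sub>C x))\<^sup>2 = (cmod a * norm x)\<^sup>2"
    by (simp add: power_mult_distrib flip: Re_cinner_self)
  then show ?thesis
    by (simp add: power2_eq_iff_nonneg)
qed

lemma norm_diff_square:
  "(norm (x - y))\<^sup>2 = (norm x)\<^sup>2 - 2 * Re (cinner x y) + (norm (y :: 'a::complex_inner))\<^sup>2"
  using Re_cinner_commute[of y x]
  by (simp add: cinner_diff_left cinner_diff_right flip: Re_cinner_self)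

lemma parallelogram_law:
  "(norm (x + y))\<^sup>2 + (norm (x - y))\<^sup>2 = 2 * (norm x)\<^sup>2 + 2 * (norm (y :: 'a::complex_inner))\<^sup>2"
  by (simp add: cinner_diff_left cinner_diff_right cinner_add_left cinner_add_right
      flip: Re_cinner_self)

text \<open>A weak Cauchy-Schwarz inequality, enough for boundedness: a unimodular \<open>c\<close>
  rotates \<open>x\<close> until the inner product is real and nonnegative, and then the square of
  \<open>norm (c *\<^sub>C x - y)\<close> is expanded.\<close>

lemma cmod_cinner_le: "cmod (cinner x y) \<le> ((norm x)\<^sup>2 + (norm y)\<^sup>2) / 2"
proof (cases "cinner x y = 0")
  case False
  define c where "c = cnj (sgn (cinner x y))"
  have "c * cinner x y = of_real (cmod (cinner x y))"
    using False complex_norm_square[of "cinner x y"]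
    by (simp add: c_def sgn_eq field_simps power2_eq_square)
  then have "cmod (cinner x y) = Re (cinner (c *\<^sub>C x) y)"
    by (simp add: cinner_scaleC_left)
  moreover have "norm (c *\<^sub>C x) = norm x"
    using False by (simp add: c_def norm_scaleC norm_sgn)
  ultimately show ?thesis
    using norm_diff_square[of "c *\<^sub>C x" y] zero_le_power2[of "norm (c *\<^sub>C x - y)"] by simp
qed simp

text \<open>Makes the \<open>Sup\<close> in \<open>numerical_radius\<close> a genuine supremum for
  norm-bounded maps.\<close>

lemma numerical_values_bounded:
  assumes "\<And>x. norm (T x) \<le> K * norm (x :: 'a::complex_inner)"
  shows "bdd_above (insert 0 {cmod (cinner (T x) x) | x. norm x = 1})"
proof (rule bdd_aboveI)
  fix v assume "v \<in> insert 0 {cmod (cinner (T x) x) | x. norm x = 1}"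
  then consider "v = 0" | x where "v = cmod (cinner (T x) x)" "norm x = 1"
    by blast
  then show "v \<le> (K\<^sup>2 + 1) / 2"
  proof cases
    case (2 x)
    then have "(norm (T x))\<^sup>2 \<le> K\<^sup>2"
      using assms[of x] by (auto intro: power_mono)
    then show ?thesis
      using cmod_cinner_le[of "T x" x] 2 by simp
  qed simp
qed

lemma cmod_cinner_le_numerical_radius:
  assumes "\<And>x. norm (T x) \<le> K * norm (x :: 'a::complex_inner)" and "norm x = 1"
  shows "cmod (cinner (T x) x) \<le> numerical_radius T"
  unfolding numerical_radius_def
  by (rule cSup_upper[OF _ numerical_values_bounded[OF assms(1)]]) (use assms(2) in auto)

lemma numerical_radius_nonneg:
  assumes "\<And>x. norm (T x) \<le> K * norm (x :: 'a::complex_inner)"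
  shows "0 \<le> numerical_radius T"
  unfolding numerical_radius_def
  by (rule cSup_upper[OF _ numerical_values_bounded[OF assms]]) simp

lemma numerical_radius_le:
  assumes "0 \<le> b" and "\<And>x. norm x = 1 \<Longrightarrow> cmod (cinner (T x) x) \<le> b"
  shows "numerical_radius T \<le> b"
  unfolding numerical_radius_def by (rule cSup_least) (use assms in auto)

text \<open>Polarization: the cross terms are the difference of the quadratic form
  \<open>Im (cinner (A y) y)\<close> at \<open>y + w\<close> and \<open>y - w\<close>, and the
  parallelogram law adds up the two bounds.\<close>

lemma Im_numerical_form_polarized_le:
  fixes A :: "'a::complex_inner \<Rightarrow> 'a"
  assumes "linear A" and "0 \<le> K"
    and bound: "\<And>y. \<bar>Im (cinner (A y) y)\<bar> \<le> K * (norm y)\<^sup>2"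
    and "norm x = 1"
  shows "Im (cinner (A x) w) + Im (cinner (A w) x) \<le> K\<^sup>2 + (norm w)\<^sup>2"
proof -
  have polarized: "2 * (Im (cinner (A y) w) + Im (cinner (A w) y))
      \<le> K * (2 * (norm y)\<^sup>2 + 2 * (norm w)\<^sup>2)" for y
  proof -
    have "2 * (Im (cinner (A y) w) + Im (cinner (A w) y))
        = Im (cinner (A (y + w)) (y + w)) - Im (cinner (A (y - w)) (y - w))"
      by (simp add: linear_add[OF \<open>linear A\<close>] linear_diff[OF \<open>linear A\<close>] cinner_add_left
          cinner_add_right cinner_diff_left cinner_diff_right)
    also have "\<dots> \<le> K * ((norm (y + w))\<^sup>2 + (norm (y - w))\<^sup>2)"
      using bound[of "y + w"] bound[of "y - w"] by (simp add: distrib_left)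
    finally show ?thesis
      by (simp only: parallelogram_law)
  qed
  show ?thesis
  proof (cases "K = 0")
    case True
    then show ?thesis
      using polarized[of x] by (simp add: add_nonneg_nonneg order_trans[OF _ zero_le_power2])
  next
    case False
    \<comment> \<open>Rescaling \<open>x\<close> to \<open>K *\<^sub>R x\<close> puts a factor
      \<open>K\<close> on both sides; cancelling it leaves \<open>K\<^sup>2\<close> as the only
      trace of the bound.\<close>
    have "K * (Im (cinner (A x) w) + Im (cinner (A w) x)) \<le> K * (K\<^sup>2 + (norm w)\<^sup>2)"
      using polarized[of "K *\<^sub>R x"] \<open>norm x = 1\<close> \<open>0 \<le> K\<close>
      by (simp add: linear_scale[OF \<open>linear A\<close>] cinner_scaleR_left cinner_scaleR_right algebra_simps)
    then show ?thesis
      using False \<open>0 \<le> K\<close> by simp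
  qed
qed

text \<open>The polarized bound is applied to \<open>w = (- \<i>) *\<^sub>C v\<close> with
  \<open>v = A x - \<beta> *\<^sub>R x\<close>. The factor \<open>- \<i>\<close> turns imaginary
  parts into real parts, the \<beta> terms cancel on the left, and the square of
  \<open>norm (A x)\<close> cancels between the two sides. Here \<beta> is any real number.\<close>

lemma Re_cinner_square_ge:
  fixes A :: "'a::complex_inner \<Rightarrow> 'a"
  assumes "bounded_clinear A" and "0 \<le> K"
    and bound: "\<And>y. \<bar>Im (cinner (A y) y)\<bar> \<le> K * (norm y)\<^sup>2"
    and "norm x = 1"
  shows "2 * \<beta> * Re (cinner (A x) x) - \<beta>\<^sup>2 - K\<^sup>2 \<le> Re (cinner (A (A x)) x)"
proof -
  interpret bounded_clinear A by fact
  define v where "v = A x - \<beta> *\<^sub>R x"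
  have "Im (cinner (A x) ((- \<i>) *\<^sub>C v)) = Re (cinner (A x) v)"
    "Im (cinner (A ((- \<i>) *\<^sub>C v)) x) = - Re (cinner (A v) x)"
    by (simp_all only: cinner_scaleC_right cinner_scaleC_left scaleC, simp_all)
  then have "Re (cinner (A x) v) - Re (cinner (A v) x) \<le> K\<^sup>2 + (norm v)\<^sup>2"
    using Im_numerical_form_polarized_le[OF linear_axioms \<open>0 \<le> K\<close> bound \<open>norm x = 1\<close>,
        of "(- \<i>) *\<^sub>C v"]
    by (simp add: norm_scaleC)
  moreover have "Re (cinner (A x) v) - Re (cinner (A v) x)
      = (norm (A x))\<^sup>2 - Re (cinner (A (A x)) x)"
    by (simp add: v_def diff scaleR cinner_diff_left cinner_diff_right cinner_scaleR_left
        cinner_scaleR_right flip: Re_cinner_self)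
  moreover have "(norm v)\<^sup>2 = (norm (A x))\<^sup>2 - 2 * \<beta> * Re (cinner (A x) x) + \<beta>\<^sup>2"
    using \<open>norm x = 1\<close> by (simp add: v_def norm_diff_square cinner_scaleR_right)
  ultimately show ?thesis
    by simp
qed

theorem theorem3p1:
  fixes A :: "'a::complex_hilbert_space \<Rightarrow> 'a" and \<alpha> :: real
  assumes "0 \<le> \<alpha>" and "\<alpha> < pi / 2"
    and "bounded_clinear A"
    and "numerical_range A \<subseteq> sector \<alpha>"
  shows "(1 - 2 * (tan \<alpha>)\<^sup>2) * (numerical_radius A)\<^sup>2 \<le> numerical_radius (A ^^ 2)"
proof -
  interpret bounded_clinear A by fact
  define t where "t = tan \<alpha>"
  \<comment> \<open>Inserting \<open>0\<close> keeps \<open>Q\<close> nonempty on the zero space and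
    gives \<open>0 \<le> \<beta>\<close>.\<close>
  define Q where "Q = insert 0 {Re (cinner (A x) x) | x. norm x = 1}"
  define \<beta> where "\<beta> = Sup Q"
  have "0 \<le> t"
    using assms(1,2) by (cases "\<alpha> = 0") (auto simp: t_def intro!: less_imp_le tan_gt_zero)
  obtain L where L: "\<And>x. norm (A x) \<le> L * norm x" "0 \<le> L"
    using nonneg_bounded by (auto simp: mult.commute)
  have L2: "norm ((A ^^ 2) x) \<le> (L * L) * norm x" for x
    using L(1)[of "A x"] mult_left_mono[OF L(1)[of x] L(2)]
    by (simp add: numeral_2_eq_2 mult.assoc)
  have Q_le: "y \<le> numerical_radius A" if "y \<in> Q" for y
    using that numerical_radius_nonneg[of A, OF L(1)]
      order_trans[OF complex_Re_le_cmod cmod_cinner_le_numerical_radius[of A, OF L(1)]]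
    by (auto simp: Q_def)
  have \<beta>_upper: "y \<le> \<beta>" if "y \<in> Q" for y
    unfolding \<beta>_def using that Q_le by (intro cSup_upper bdd_aboveI[of Q "numerical_radius A"])
  then have "0 \<le> \<beta>" and Re_le: "\<And>x. norm x = 1 \<Longrightarrow> Re (cinner (A x) x) \<le> \<beta>"
    by (auto simp: Q_def)
  have sector: "0 < Re (cinner (A x) x)" "\<bar>Im (cinner (A x) x)\<bar> \<le> t * Re (cinner (A x) x)"
    if "norm x = 1" for x
    using assms(4) that by (auto simp: numerical_range_def sector_def t_def)
  have Im_le: "\<bar>Im (cinner (A x) x)\<bar> \<le> t * \<beta>" if "norm x = 1" for x
    using sector(2)[OF that] mult_left_mono[OF Re_le[OF that] \<open>0 \<le> t\<close>] by linarith
  \<comment> \<open>Both sides are homogeneous of degree two, so normalizing \<open>y\<close>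
    reduces this to unit vectors.\<close>
  have Im_le_norm: "\<bar>Im (cinner (A y) y)\<bar> \<le> (t * \<beta>) * (norm y)\<^sup>2" for y
  proof (cases "y = 0")
    case True
    then show ?thesis
      by (simp add: zero cinner_eq_zero_iff[THEN iffD2])
  next
    case False
    define x where "x = inverse (norm y) *\<^sub>R y"
    have "norm x = 1" and y: "y = norm y *\<^sub>R x"
      using False by (simp_all add: x_def)
    have "cinner (A y) y = of_real ((norm y)\<^sup>2) * cinner (A x) x"
      by (subst (1 2) y)
        (simp add: scaleR cinner_scaleR_left cinner_scaleR_right power2_eq_square)
    then have "\<bar>Im (cinner (A y) y)\<bar> = \<bar>Im (cinner (A x) x)\<bar> * (norm y)\<^sup>2"
      by (simp add: abs_mult)
    then show ?thesis
      using mult_right_mono[OF Im_le[OF \<open>norm x = 1\<close>], of "(norm y)\<^sup>2"] by simp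
  qed
  have radius_square: "2 * \<beta> * y \<le> numerical_radius (A ^^ 2) + (1 + t\<^sup>2) * \<beta>\<^sup>2" if "y \<in> Q" for y
  proof (cases "y = 0")
    case True
    then show ?thesis
      using numerical_radius_nonneg[of "A ^^ 2", OF L2] by simp
  next
    case False
    then obtain x where x: "norm x = 1" "y = Re (cinner (A x) x)"
      using \<open>y \<in> Q\<close> by (auto simp: Q_def)
    have "2 * \<beta> * y - \<beta>\<^sup>2 - (t * \<beta>)\<^sup>2 \<le> Re (cinner (A (A x)) x)"
      unfolding x(2) using \<open>0 \<le> t\<close> \<open>0 \<le> \<beta>\<close>
      by (intro Re_cinner_square_ge[OF assms(3) _ Im_le_norm x(1)]) simp
    also have "\<dots> \<le> cmod (cinner ((A ^^ 2) x) x)"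
      by (simp add: numeral_2_eq_2 complex_Re_le_cmod)
    also have "\<dots> \<le> numerical_radius (A ^^ 2)"
      by (rule cmod_cinner_le_numerical_radius[OF L2 x(1)])
    finally show ?thesis
      by (simp add: power_mult_distrib algebra_simps)
  qed
  have square_ge: "(1 - t\<^sup>2) * \<beta>\<^sup>2 \<le> numerical_radius (A ^^ 2)"
  proof (cases "\<beta> = 0")
    case True
    then show ?thesis
      using numerical_radius_nonneg[of "A ^^ 2", OF L2] by simp
  next
    case False
    then have "0 < \<beta>"
      using \<open>0 \<le> \<beta>\<close> by simp
    \<comment> \<open>The estimate is linear in \<open>y\<close>, so it passes to the supremum and
      becomes \<open>2 * \<beta>\<^sup>2 \<le> numerical_radius (A ^^ 2) + (1 + t\<^sup>2) *
      \<beta>\<^sup>2\<close>.\<close>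
    then have "y \<le> (numerical_radius (A ^^ 2) + (1 + t\<^sup>2) * \<beta>\<^sup>2) / (2 * \<beta>)" if "y \<in> Q" for y
      using radius_square[OF that] by (simp add: field_simps)
    then have "\<beta> \<le> (numerical_radius (A ^^ 2) + (1 + t\<^sup>2) * \<beta>\<^sup>2) / (2 * \<beta>)"
      by (subst (1) \<beta>_def, intro cSup_least) (auto simp: Q_def)
    then show ?thesis
      using \<open>0 < \<beta>\<close> by (simp add: field_simps power2_eq_square)
  qed
  have "numerical_radius A \<le> sqrt ((1 + t\<^sup>2) * \<beta>\<^sup>2)"
  proof (rule numerical_radius_le)
    fix x :: 'a assume x: "norm x = 1"
    \<comment> \<open>Positivity of the real part, from the sector, is what allows squaring the
      one-sided bound by \<beta>.\<close>
    have "(Re (cinner (A x) x))\<^sup>2 \<le> \<beta>\<^sup>2"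
      using Re_le[OF x] sector(1)[OF x] by (intro power_mono) auto
    moreover have "(Im (cinner (A x) x))\<^sup>2 \<le> (t * \<beta>)\<^sup>2"
      using Im_le[OF x] power_mono[of "\<bar>Im (cinner (A x) x)\<bar>" "t * \<beta>" 2] by simp
    ultimately show "cmod (cinner (A x) x) \<le> sqrt ((1 + t\<^sup>2) * \<beta>\<^sup>2)"
      unfolding cmod_def by (intro real_sqrt_le_mono) (simp add: power_mult_distrib algebra_simps)
  qed simp
  then have radius_le: "(numerical_radius A)\<^sup>2 \<le> (1 + t\<^sup>2) * \<beta>\<^sup>2"
    using power_mono[OF _ numerical_radius_nonneg[of A, OF L(1)], of _ 2] by fastforce
  show ?thesis
  proof (cases "1 - 2 * t\<^sup>2 \<le> 0")
    case True
    \<comment> \<open>Multiplying \<open>radius_le\<close> by a negative factor would reverse it,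
      but in this case the left side of the claim is already nonpositive.\<close>
    then have "(1 - 2 * t\<^sup>2) * (numerical_radius A)\<^sup>2 \<le> 0"
      by (simp add: mult_nonpos_nonneg)
    then show ?thesis
      using numerical_radius_nonneg[of "A ^^ 2", OF L2] by (simp add: t_def)
  next
    case False
    then have "(1 - 2 * t\<^sup>2) * (numerical_radius A)\<^sup>2 \<le> (1 - 2 * t\<^sup>2) * ((1 + t\<^sup>2) * \<beta>\<^sup>2)"
      using radius_le by (intro mult_left_mono) auto
    also have "\<dots> = (1 - t\<^sup>2) * \<beta>\<^sup>2 - 2 * (t\<^sup>2 * \<beta>)\<^sup>2"
      by (simp add: algebra_simps power2_eq_square)
    also have "\<dots> \<le> (1 - t\<^sup>2) * \<beta>\<^sup>2"
      by simp
    finally show ?thesis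
      using square_ge by (simp add: t_def)
  qed
qed

end
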